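(* Let $f:\mathbb{R}^n\to\overline{\mathbb{R}}$ be an implicit convex function, i.e. $f(x)=V(\Phi(x))$ for $x\in C$ and $f(x)=+\infty$ otherwise, where $C\subseteq\mathbb{R}^n$ is a non-empty convex set, $V:\mathbb{R}^m\to\overline{\mathbb{R}}$ is proper, convex and lower semicontinuous, and $\Phi:\mathbb{R}^n\to\mathbb{R}^m$ is a nonlinear continuous mapping. Let $V^*$ be the convex conjugate of $V$, let $D=\{\sigma\in\mathbb{R}^m: V^*(\sigma)<\infty\}$, and let the dual function be $$g(\sigma)=\inf_{x\in C}\left\{\langle\Phi(x),\sigma\rangle-V^*(\sigma)\right\}.$$ Then for every $x\in C$ and every $\sigma\in D$, $$g(\sigma)\le f(x).$$
   Context: $\overline{\mathbb{R}}=[-\infty,\infty]$. A function is proper if it never takes the value $-\infty$ and is not identically $+\infty$. The convex conjugate is $V^*(\sigma)=\sup_{y\in\mathbb{R}^m}\{\langle y,\sigma\rangle-V(y)\}$. *)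

theory Defs
  imports "HOL-Analysis.Analysis"
begin

definition proper_fun :: "('a \<Rightarrow> ereal) \<Rightarrow> bool" where
  "proper_fun V \<longleftrightarrow> (\<forall>y. V y \<noteq> -\<infinity>) \<and> (\<exists>y. V y \<noteq> \<infinity>)"

(* Convexity of an extended-real-valued function through its epigraph, which lies in 'a \<times> real;
   the library constants epigraph and convex_on only cover real-valued functions. *)
definition convex_fun :: "('a::real_vector \<Rightarrow> ereal) \<Rightarrow> bool" where
  "convex_fun V \<longleftrightarrow> convex {(y, r :: real). V y \<le> ereal r}"

definition lsc_fun :: "('a::topological_space \<Rightarrow> ereal) \<Rightarrow> bool" where
  "lsc_fun V \<longleftrightarrow> (\<forall>y. V y \<le> Liminf (at y) V)"

definition conjugate :: "('a::real_inner \<Rightarrow> ereal) \<Rightarrow> 'a \<Rightarrow> ereal" where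
  "conjugate V \<sigma> = (SUP y. ereal (y \<bullet> \<sigma>) - V y)"

definition dual_domain :: "('a::real_inner \<Rightarrow> ereal) \<Rightarrow> 'a set" where
  "dual_domain V = {\<sigma>. conjugate V \<sigma> < \<infinity>}"

(* "Nonlinear" for \<Phi> is read as "not necessarily linear", hence imposes no condition. *)
definition implicit_convex_fun ::
  "(real ^ 'n \<Rightarrow> ereal) \<Rightarrow> (real ^ 'n) set \<Rightarrow> (real ^ 'm \<Rightarrow> ereal) \<Rightarrow> (real ^ 'n \<Rightarrow> real ^ 'm) \<Rightarrow> bool"
where
  "implicit_convex_fun f C V \<Phi> \<longleftrightarrow>
     C \<noteq> {} \<and> convex C \<and>
     proper_fun V \<and> convex_fun V \<and> lsc_fun V \<and>
     continuous_on UNIV \<Phi> \<and>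
     (\<forall>x. f x = (if x \<in> C then V (\<Phi> x) else \<infinity>))"

definition dual_fun ::
  "(real ^ 'n) set \<Rightarrow> (real ^ 'm \<Rightarrow> ereal) \<Rightarrow> (real ^ 'n \<Rightarrow> real ^ 'm) \<Rightarrow> real ^ 'm \<Rightarrow> ereal"
where
  "dual_fun C V \<Phi> \<sigma> = (INF x\<in>C. ereal (\<Phi> x \<bullet> \<sigma>) - conjugate V \<sigma>)"

end

theory Submission
  imports Defs
begin

text \<open>This is weak duality: each x in C contributes one term to the infimum defining
  \<open>dual_fun\<close>, and the Fenchel-Young inequality \<open>fenchel_young\<close>, taken at y
  = \<open>\<Phi> x\<close>, bounds that very term by \<open>V (\<Phi> x)\<close>, which is
  \<open>f x\<close> on C.\<close>

lemma fenchel_young: "ereal (y \<bullet> \<sigma>) - conjugate V \<sigma> \<le> V y"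
proof -
  have "ereal (y \<bullet> \<sigma>) - V y \<le> conjugate V \<sigma>"
    unfolding conjugate_def by (rule SUP_upper) simp
  then show ?thesis
    \<comment> \<open>Exchanging the two terms is delicate only at infinite values:
      \<open>V y\<close> = -\<infinity> forces the conjugate to be \<infinity>, so the left side is
      -\<infinity>; a real \<open>V y\<close> rules out a conjugate equal to -\<infinity>;
      \<open>V y\<close> = \<infinity> is trivial.\<close>
    by (cases "V y"; cases "conjugate V \<sigma>") auto
qed

theorem theorem2:
  fixes f :: "real ^ 'n \<Rightarrow> ereal"
    and C :: "(real ^ 'n) set"
    and V :: "real ^ 'm \<Rightarrow> ereal"
    and \<Phi> :: "real ^ 'n \<Rightarrow> real ^ 'm"
  assumes "implicit_convex_fun f C V \<Phi>"
  shows "\<forall>x\<in>C. \<forall>\<sigma>\<in>dual_domain V. dual_fun C V \<Phi> \<sigma> \<le> f x"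
proof (intro ballI)
  fix x \<sigma>
  assume "x \<in> C"
  then have "dual_fun C V \<Phi> \<sigma> \<le> ereal (\<Phi> x \<bullet> \<sigma>) - conjugate V \<sigma>"
    unfolding dual_fun_def by (rule INF_lower)
  also have "\<dots> \<le> V (\<Phi> x)"
    by (rule fenchel_young)
  also have "V (\<Phi> x) = f x"
    using assms \<open>x \<in> C\<close> by (simp add: implicit_convex_fun_def)
  finally show "dual_fun C V \<Phi> \<sigma> \<le> f x" .
qed

end
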